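(* Let $N\ge 1$ and let $W:\mathbb{R}^N\to\mathbb{R}$ satisfy (NL0), (NL1), (NL2), (NL-RAD) and (NL-CONF). Then for every $\bar R_0>0$ there exists $\bar R>0$, depending only on $W$ and $\bar R_0$ (in particular independent of the number of particles, of the masses and of the initial positions), such that the following holds. For every integer $n\ge 1$, all masses $m_1,\dots,m_n\ge 0$ with $\sum_{i=1}^n m_i=1$, and all initial positions $x_1(0),\dots,x_n(0)\in B(0,\bar R_0)$ with $\sum_{i=1}^n m_i x_i(0)=0$, every solution $(x_1(t),\dots,x_n(t))$, $t\ge 0$, of the particle system $$\dot x_i=-\sum_{j\in Z(i)} m_j\nabla W(x_i-x_j),\qquad i=1,\dots,n,$$ with these initial positions satisfies $x_i(t)\in B(0,\bar R)$ for all $t\ge 0$ and all $i=1,\dots,n$.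
   Context: $B(0,r)$ is the ball of radius $r$ centered at $0$ in $\mathbb{R}^N$. The assumptions on $W$ are: (NL0) $W\in C(\mathbb{R}^N)\cap C^1(\mathbb{R}^N\setminus\{0\})$, $W(x)=W(-x)$, and $W(0)=0$. (NL1) $W$ is $\lambda$-convex for a certain $\lambda\in\mathbb{R}$, i.e. $W(x)-\frac{\lambda}{2}|x|^2$ is convex. (NL2) There exists a constant $C>0$ such that $W(z)\le C(1+|z|^2)$ for all $z\in\mathbb{R}^N$. (NL-RAD) $W$ is radial, i.e. $W(x)=w(|x|)$, and there exists $R_a\ge 0$ such that $w'(r)\ge 0$ for all $r\ge R_a$ (with $r>0$). (NL-CONF) $\lim_{r\to\infty} w'(r)\,r=+\infty$. In the particle system, $Z(i)=Z(i)(t)=\{j\in\{1,\dots,n\}: j\ne i,\ x_j(t)\ne x_i(t)\}$. A solution is a family of continuous curves $x_i:[0,\infty)\to\mathbb{R}^N$ for which there is a finite set of times (collision times) such that, away from these times, each $x_i$ is continuously differentiable and satisfies the system. *)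

theory Defs
  imports "HOL-Analysis.Analysis"
begin

definition grad :: "(real ^ 'N \<Rightarrow> real) \<Rightarrow> real ^ 'N \<Rightarrow> real ^ 'N" where
  "grad W z = (THE D. GDERIV W z :> D)"

definition NL0 :: "(real ^ 'N \<Rightarrow> real) \<Rightarrow> bool" where
  "NL0 W \<longleftrightarrow>
     continuous_on UNIV W \<and>
     (\<forall>z. z \<noteq> 0 \<longrightarrow> W differentiable (at z)) \<and> continuous_on (- {0}) (grad W) \<and>
     (\<forall>z. W z = W (- z)) \<and> W 0 = 0"

definition NL1 :: "(real ^ 'N \<Rightarrow> real) \<Rightarrow> bool" where
  "NL1 W \<longleftrightarrow> (\<exists>l::real. convex_on UNIV (\<lambda>z. W z - l / 2 * (norm z)\<^sup>2))"

definition NL2 :: "(real ^ 'N \<Rightarrow> real) \<Rightarrow> bool" where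
  "NL2 W \<longleftrightarrow> (\<exists>C>0. \<forall>z. W z \<le> C * (1 + (norm z)\<^sup>2))"

(* Two radial profiles w of the same W agree on [0, \<infinity>), so the derivatives at r > 0
   used in NL_RAD and NL_CONF do not depend on the choice of w.  Under NL0 a profile is
   differentiable at every r > 0, so deriv is the genuine derivative there. *)
definition radial_profile :: "(real ^ 'N \<Rightarrow> real) \<Rightarrow> (real \<Rightarrow> real) \<Rightarrow> bool" where
  "radial_profile W w \<longleftrightarrow> (\<forall>z. W z = w (norm z))"

definition NL_RAD :: "(real ^ 'N \<Rightarrow> real) \<Rightarrow> bool" where
  "NL_RAD W \<longleftrightarrow>
     (\<exists>w. radial_profile W w \<and> (\<exists>Ra\<ge>0. \<forall>r\<ge>Ra. r > 0 \<longrightarrow> deriv w r \<ge> 0))"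

definition NL_CONF :: "(real ^ 'N \<Rightarrow> real) \<Rightarrow> bool" where
  "NL_CONF W \<longleftrightarrow>
     (\<exists>w. radial_profile W w \<and> filterlim (\<lambda>r. deriv w r * r) at_top at_top)"

definition interacting :: "nat \<Rightarrow> (nat \<Rightarrow> real \<Rightarrow> real ^ 'N) \<Rightarrow> nat \<Rightarrow> real \<Rightarrow> nat set" where
  "interacting n x i t = {j \<in> {1..n}. j \<noteq> i \<and> x j t \<noteq> x i t}"

(* T contains the collision times; the derivative at t = 0 (if 0 is not in T) is one-sided. *)
definition particle_solution ::
    "(real ^ 'N \<Rightarrow> real) \<Rightarrow> nat \<Rightarrow> (nat \<Rightarrow> real) \<Rightarrow> (nat \<Rightarrow> real \<Rightarrow> real ^ 'N) \<Rightarrow> bool" where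
  "particle_solution W n m x \<longleftrightarrow>
     (\<forall>i\<in>{1..n}. continuous_on {0..} (x i)) \<and>
     (\<exists>T. finite T \<and>
        (\<forall>i\<in>{1..n}. \<exists>v. continuous_on ({0..} - T) v \<and>
           (\<forall>t\<in>{0..} - T.
              (x i has_vector_derivative v t) (at t within {0..}) \<and>
              v t = - (\<Sum>j\<in>interacting n x i t. m j *\<^sub>R grad W (x i t - x j t)))))"

end

theory Submission
  imports Defs
begin

text \<open>
  Write \<open>\<nabla>W z = g \<bar>z\<bar> z\<close> with \<open>g r = w' r / r\<close>.  Semiconvexity and evenness give \<open>g \<ge> - L\<close>
  (\<open>radial_profile_deriv_ge\<close>), so repulsion at short range is at most linear, and confinement says
  \<open>g r r\<^sup>2 \<rightarrow> \<infinity>\<close>.  A particle at maximal distance \<open>R\<close> from the origin sees every other particle in the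
  half space on its inner side: each distant one pulls it inward with a radial component of order
  \<open>K / R\<close>, whereas each nearby one may push it outward with a force of order one.  Since the centre
  of mass stays at \<open>0\<close>, a fixed fraction of the mass is distant, so the inward pull wins as soon as
  the mass near the extremal particle is \<open>o(1 / R)\<close>.

  The fourth moment \<open>F = \<Sum>i. m i \<bar>x i\<bar>^4\<close> provides this smallness.  The field \<open>\<bar>x\<bar>\<^sup>2 x\<close> is monotone, so
  every attracting pair decreases \<open>F\<close>.  Because the centre of mass is \<open>0\<close>, the attraction of distant
  pairs controls the second moment \<open>M\<close> up to a constant, and for \<open>K\<close> large it also absorbs the
  repulsion of close pairs.  This yields \<open>F' \<le> c - 4 M\<close> (\<open>fourth_moment_dissipation\<close>).  As long as
  all particles stay in the ball of radius \<open>R\<close> one has \<open>F \<le> R\<^sup>2 M\<close>, whence \<open>F = O(R\<^sup>2)\<close>.  The mass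
  near a point at distance \<open>R\<close> is then \<open>O(R\<^sup>2 / R^4)\<close>, and the repulsion contributes only \<open>O(1 / R)\<close> to
  the growth of \<open>\<bar>x i\<bar>\<^sup>2\<close> against a fixed negative contribution
  (\<open>extremal_particle_pulled_inward\<close>).  No constant depends on the masses or on their number.

  Both differential inequalities hold off the collision times only.  The maximum principle
  (\<open>barrier_off_finite_set\<close>) is therefore run at a level that is not attained at any collision time.
\<close>

section \<open>Barriers for functions differentiable off a finite set\<close>

text \<open>A maximum principle for the maximum of finitely many functions: at the first time at which the
  maximum reaches a level \<open>y\<close>, a function attaining it cannot have negative derivative.  The interval
  \<open>(a, b)\<close> of levels leaves room to choose \<open>y\<close> so that this time avoids the exceptional set, where
  nothing beyond continuity is known.\<close>

lemma barrier_off_finite_set: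
  fixes f :: "'i \<Rightarrow> real \<Rightarrow> real"
  assumes I: "finite I" and T: "finite T" and ab: "a < b"
    and cont: "\<And>i. i \<in> I \<Longrightarrow> continuous_on {0..s} (f i)"
    and init: "\<And>i. i \<in> I \<Longrightarrow> f i 0 \<le> a"
    and decr: "\<And>i y t. \<lbrakk>i \<in> I; a < y; y < b; 0 < t; t \<le> s; t \<notin> T; f i t = y;
                \<And>j u. j \<in> I \<Longrightarrow> 0 \<le> u \<Longrightarrow> u \<le> t \<Longrightarrow> f j u \<le> y\<rbrakk>
              \<Longrightarrow> \<exists>D<0. (f i has_real_derivative D) (at t within {0..})"
    and i: "i \<in> I" and t: "0 \<le> t" "t \<le> s"
  shows "f i t < b"
proof (rule ccontr)
  assume "\<not> f i t < b"
  then have ge: "b \<le> f i t" by simp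
  have "finite (\<Union>j\<in>I. f j ` T)" using I T by auto
  then have "infinite ({a<..<b} - (\<Union>j\<in>I. f j ` T))"
    using ab infinite_Ioo by (metis Diff_infinite_finite)
  then obtain y where "y \<in> {a<..<b} - (\<Union>j\<in>I. f j ` T)"
    using infinite_imp_nonempty by blast
  then have y: "a < y" "y < b" and yT: "\<And>j u. j \<in> I \<Longrightarrow> u \<in> T \<Longrightarrow> f j u \<noteq> y"
    by auto
  define A where "A = (\<Union>j\<in>I. {0..t} \<inter> f j -` {y..})"
  have "compact ({0..t} \<inter> f j -` {y..})" if "j \<in> I" for j
  proof -
    have "continuous_on {0..t} (f j)"
      using cont[OF that] t by (auto intro: continuous_on_subset)
    then have "closed ({0..t} \<inter> f j -` {y..})"
      by (intro continuous_closed_preimage) auto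
    then show ?thesis by (metis Int_lower1 bounded_closed_interval bounded_subset compact_eq_bounded_closed)
  qed
  then have "compact A" unfolding A_def using I by (intro compact_UN) auto
  moreover have "t \<in> A" unfolding A_def using i t ge y by (auto intro!: bexI[of _ i])
  ultimately obtain r where rA: "r \<in> A" and rmin: "\<And>u. u \<in> A \<Longrightarrow> r \<le> u"
    using compact_attains_inf[of A] by (metis all_not_in_conv)
  obtain k where k: "k \<in> I" "y \<le> f k r" and r: "0 \<le> r" "r \<le> t"
    using rA unfolding A_def by auto
  have before: "f j u < y" if "j \<in> I" "0 \<le> u" "u < r" for j u
    using rmin[of u] that r unfolding A_def by fastforce
  have r0: "0 < r" using init[OF k(1)] k(2) y r(1) by (cases "r = 0") auto
  have le: "f j r \<le> y" if j: "j \<in> I" for j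
  proof (rule ccontr)
    assume "\<not> f j r \<le> y"
    moreover have "continuous_on {0..r} (f j)"
      using cont[OF j] t r by (auto intro: continuous_on_subset)
    ultimately obtain u where u: "0 \<le> u" "u \<le> r" "f j u = y"
      using IVT'[of "f j" 0 y r] init[OF j] y r by auto
    then have "u < r" using \<open>\<not> f j r \<le> y\<close> by (cases "u = r") auto
    with before[OF j u(1)] u(3) show False by simp
  qed
  have fk: "f k r = y" using k le[of k] by simp
  then have "r \<notin> T" using yT k(1) by blast
  moreover have "f j u \<le> y" if "j \<in> I" "0 \<le> u" "u \<le> r" for j u
    using before[of j u] le[of j] that by (cases "u = r") auto
  ultimately obtain D where D: "D < 0" "(f k has_real_derivative D) (at r within {0..})"
    using decr[OF k(1) y r0 _ _ fk] r t by force
  obtain d where d: "d > 0" "\<And>h. 0 < h \<Longrightarrow> r - h \<in> {0..} \<Longrightarrow> h < d \<Longrightarrow> f k r < f k (r - h)"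
    using has_real_derivative_neg_dec_left[OF D(2,1)] by auto
  define h where "h = min r d / 2"
  have "f k r < f k (r - h)" using d r0 unfolding h_def by (intro d(2)) auto
  moreover have "f k (r - h) < y" using before[of k "r - h"] k(1) d r0 unfolding h_def by auto
  ultimately show False using fk by simp
qed

section \<open>The force of a radial semiconvex potential\<close>

lemma radial_profile_has_derivative:
  fixes W :: "real ^ 'N \<Rightarrow> real"
  assumes W: "NL0 W" and w: "radial_profile W w" and r: "r > 0"
  shows "(w has_real_derivative deriv w r) (at r)"
proof -
  obtain e :: "real ^ 'N" where e: "norm e = 1" using vector_choose_size[of 1] by auto
  have "r *\<^sub>R e \<noteq> 0" using r e by auto
  then have "W differentiable (at (r *\<^sub>R e))" using W unfolding NL0_def by blast
  then obtain W' where "(W has_derivative W') (at (r *\<^sub>R e))" unfolding differentiable_def by auto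
  then have "((\<lambda>s. W (s *\<^sub>R e)) has_derivative (\<lambda>s. W' (s *\<^sub>R e))) (at r)"
    using has_derivative_compose[OF bounded_linear_imp_has_derivative[OF bounded_linear_scaleR_left]]
    by blast
  then have "(\<lambda>s. W (s *\<^sub>R e)) differentiable (at r)" unfolding differentiable_def by auto
  then obtain D where D: "((\<lambda>s. W (s *\<^sub>R e)) has_real_derivative D) (at r)"
    using real_differentiable_def by auto
  have "(w has_real_derivative D) (at r)"
  proof (rule has_field_derivative_transform_within_open[OF D])
    show "open {0::real<..}" "r \<in> {0<..}" using r by auto
    show "W (s *\<^sub>R e) = w s" if "s \<in> {0<..}" for s
      using w that e unfolding radial_profile_def by simp
  qed
  then show ?thesis using DERIV_imp_deriv by fastforce
qed

lemma grad_radial: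
  fixes W :: "real ^ 'N \<Rightarrow> real"
  assumes W: "NL0 W" and w: "radial_profile W w" and z: "z \<noteq> 0"
  shows "grad W z = (deriv w (norm z) / norm z) *\<^sub>R z"
proof -
  have "GDERIV (\<lambda>z. w (norm z)) z :> deriv w (norm z) *\<^sub>R sgn z"
    using GDERIV_DERIV_compose[OF GDERIV_norm[OF z]] radial_profile_has_derivative[OF W w] z by auto
  moreover have "(\<lambda>z. w (norm z)) = W" using w unfolding radial_profile_def by auto
  ultimately have G: "GDERIV W z :> deriv w (norm z) *\<^sub>R sgn z" by simp
  have "D = deriv w (norm z) *\<^sub>R sgn z" if "GDERIV W z :> D" for D
  proof -
    have "(\<lambda>h. h \<bullet> D) = (\<lambda>h. h \<bullet> (deriv w (norm z) *\<^sub>R sgn z))"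
      using has_derivative_unique that G unfolding gderiv_def by blast
    then show ?thesis by (metis inner_commute vector_eq_ldot)
  qed
  then have "grad W z = deriv w (norm z) *\<^sub>R sgn z"
    unfolding grad_def by (rule the_equality[where P = "\<lambda>D. GDERIV W z :> D", OF G])
  then show ?thesis by (simp add: sgn_div_norm divide_inverse)
qed

text \<open>A \<open>\<lambda>\<close>-convex even potential minus its quadratic part is an even convex function, hence
  nondecreasing along rays.  This bounds the repulsion at short range from below.\<close>

lemma radial_profile_deriv_ge:
  fixes W :: "real ^ 'N \<Rightarrow> real"
  assumes W: "NL0 W" and w: "radial_profile W w" and r: "r > 0"
    and conv: "convex_on UNIV (\<lambda>z. W z - l / 2 * (norm z)\<^sup>2)"
  shows "l * r \<le> deriv w r"
proof (rule ccontr)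
  assume neg: "\<not> l * r \<le> deriv w r"
  obtain e :: "real ^ 'N" where e: "norm e = 1" using vector_choose_size[of 1] by auto
  define p where "p = (\<lambda>s. w s - l / 2 * s\<^sup>2)"
  have mono: "p s \<le> p r" if s: "0 < s" "s < r" for s
  proof -
    define u where "u = (1 - s / r) / 2"
    have u: "0 \<le> u" "u \<le> 1" using s by (auto simp: u_def field_simps)
    have "(1 - u) *\<^sub>R (r *\<^sub>R e) + u *\<^sub>R (- (r *\<^sub>R e)) = s *\<^sub>R e"
      using r by (simp add: u_def flip: scaleR_left.add scaleR_left.diff scaleR_left_diff_distrib)
        (simp add: field_simps)
    then have "W (s *\<^sub>R e) - l / 2 * (norm (s *\<^sub>R e))\<^sup>2
        \<le> (1 - u) * (W (r *\<^sub>R e) - l / 2 * (norm (r *\<^sub>R e))\<^sup>2)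
          + u * (W (- (r *\<^sub>R e)) - l / 2 * (norm (- (r *\<^sub>R e)))\<^sup>2)"
      using convex_onD[OF conv u, of "r *\<^sub>R e" "- (r *\<^sub>R e)"] by simp
    then have "p s \<le> (1 - u) * p r + u * p r"
      using w e s r unfolding radial_profile_def p_def by simp
    then show ?thesis by (simp add: algebra_simps)
  qed
  have "(p has_real_derivative (deriv w r - l * r)) (at r)"
    unfolding p_def
    by (auto intro!: derivative_eq_intros radial_profile_has_derivative[OF W w r])
  then obtain d where d: "d > 0" "\<And>h. 0 < h \<Longrightarrow> h < d \<Longrightarrow> p r < p (r - h)"
    using has_real_derivative_neg_dec_left[of p "deriv w r - l * r" r UNIV] neg by auto
  define h where "h = min r d / 2"
  have "p r < p (r - h)" using d r unfolding h_def by (intro d(2)) auto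
  moreover have "p (r - h) \<le> p r" using d r unfolding h_def by (intro mono) auto
  ultimately show False by simp
qed

section \<open>Two inequalities for configurations with centre of mass at the origin\<close>

text \<open>The field \<open>\<bar>x\<bar>\<^sup>2 x\<close> is a quarter of the gradient of \<open>\<bar>x\<bar>^4\<close>; these bounds decide how much a
  pair force along \<open>a - b\<close> changes the fourth moment.\<close>

lemma cubic_monotone_lower:
  fixes a b :: "'a::real_inner"
  shows "((norm a)\<^sup>2 + (norm b)\<^sup>2) / 2 * (norm (a - b))\<^sup>2
       \<le> (a - b) \<bullet> ((norm a)\<^sup>2 *\<^sub>R a - (norm b)\<^sup>2 *\<^sub>R b)"
    and cubic_monotone_upper:
  "(a - b) \<bullet> ((norm a)\<^sup>2 *\<^sub>R a - (norm b)\<^sup>2 *\<^sub>R b)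
       \<le> 3 / 2 * ((norm a)\<^sup>2 + (norm b)\<^sup>2) * (norm (a - b))\<^sup>2"
proof -
  have eq: "(a - b) \<bullet> ((norm a)\<^sup>2 *\<^sub>R a - (norm b)\<^sup>2 *\<^sub>R b)
      = ((norm a)\<^sup>2 + (norm b)\<^sup>2) / 2 * (norm (a - b))\<^sup>2 + ((norm a)\<^sup>2 - (norm b)\<^sup>2)\<^sup>2 / 2"
    by (simp add: power2_norm_eq_inner inner_simps)
      (simp add: power2_eq_square inner_commute field_simps)
  show "((norm a)\<^sup>2 + (norm b)\<^sup>2) / 2 * (norm (a - b))\<^sup>2
       \<le> (a - b) \<bullet> ((norm a)\<^sup>2 *\<^sub>R a - (norm b)\<^sup>2 *\<^sub>R b)"
    unfolding eq by simp
  have "((norm a)\<^sup>2 - (norm b)\<^sup>2)\<^sup>2 = (norm a + norm b)\<^sup>2 * \<bar>norm a - norm b\<bar>\<^sup>2"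
    by (simp add: power2_eq_square algebra_simps)
  also have "\<dots> \<le> (2 * ((norm a)\<^sup>2 + (norm b)\<^sup>2)) * (norm (a - b))\<^sup>2"
  proof (intro mult_mono power_mono norm_triangle_ineq3)
    show "(norm a + norm b)\<^sup>2 \<le> 2 * ((norm a)\<^sup>2 + (norm b)\<^sup>2)"
      using sum_squares_bound[of "norm a" "norm b"] by (simp add: power2_sum)
  qed auto
  finally show "(a - b) \<bullet> ((norm a)\<^sup>2 *\<^sub>R a - (norm b)\<^sup>2 *\<^sub>R b)
       \<le> 3 / 2 * ((norm a)\<^sup>2 + (norm b)\<^sup>2) * (norm (a - b))\<^sup>2"
    unfolding eq by (simp only: algebra_simps) argo
qed

lemma norm_diff_sq_le:
  fixes a b :: "'a::real_inner"
  shows "(norm (a - b))\<^sup>2 \<le> 2 * ((norm a)\<^sup>2 + (norm b)\<^sup>2)"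
proof -
  have "(norm (a - b))\<^sup>2 + (norm (a + b))\<^sup>2 = 2 * ((norm a)\<^sup>2 + (norm b)\<^sup>2)"
    by (simp add: power2_norm_eq_inner inner_simps inner_commute)
  then show ?thesis by (smt (verit) zero_le_power2)
qed

text \<open>Forces may repel at most linearly below \<open>\<rho>0\<close>, attract beyond \<open>\<rho>0\<close>, and attract with strength at
  least \<open>K / r\<close> beyond \<open>\<rho>\<close>.  The value of \<open>K\<close> is what makes the distant attraction dominate: in the sum of
  \<open>pair_dissipation\<close> over all pairs the second moment has coefficient
  \<open>K / 2 - 3 L \<rho>0\<^sup>2 = 2\<close>.\<close>

locale confining_force =
  fixes g :: "real \<Rightarrow> real" and L \<rho>0 \<rho> K :: real
  assumes L: "0 \<le> L" and \<rho>0: "0 < \<rho>0" and \<rho>: "\<rho>0 \<le> \<rho>"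
    and g_ge: "\<And>r. 0 < r \<Longrightarrow> - L \<le> g r"
    and g_nonneg: "\<And>r. \<rho>0 \<le> r \<Longrightarrow> 0 \<le> g r"
    and g_far: "\<And>r. \<rho> \<le> r \<Longrightarrow> K \<le> g r * r\<^sup>2"
    and K: "K = 6 * L * \<rho>0\<^sup>2 + 4"
begin

definition force :: "'a::real_inner \<Rightarrow> 'a" where
  "force z = g (norm z) *\<^sub>R z"

lemma force_minus: "force (- z) = - force z"
  by (simp add: force_def)

lemma force_0: "force 0 = 0"
  by (simp add: force_def)

lemma K_pos: "4 \<le> K"
  using L K by simp

text \<open>The lower bound is written as a multiple of \<open>\<bar>a - b\<bar>\<^sup>2 - \<rho>\<^sup>2\<close>, which is nonpositive for close
  pairs, so that summing over pairs needs no case distinction: with centre of mass \<open>0\<close> the squares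
  \<open>\<bar>a - b\<bar>\<^sup>2\<close> sum to twice the second moment.\<close>

lemma pair_dissipation:
  fixes a b :: "'a::real_inner"
  shows "K / 4 * ((norm (a - b))\<^sup>2 - \<rho>\<^sup>2) - 3 / 2 * L * \<rho>0\<^sup>2 * ((norm a)\<^sup>2 + (norm b)\<^sup>2)
      \<le> force (a - b) \<bullet> ((norm a)\<^sup>2 *\<^sub>R a - (norm b)\<^sup>2 *\<^sub>R b)" (is "?l \<le> ?r")
proof -
  define r where "r = norm (a - b)"
  define S where "S = (norm a)\<^sup>2 + (norm b)\<^sup>2"
  define Q where "Q = (a - b) \<bullet> ((norm a)\<^sup>2 *\<^sub>R a - (norm b)\<^sup>2 *\<^sub>R b)"
  have S: "0 \<le> S" and r: "0 \<le> r" by (auto simp: S_def r_def)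
  have Q1: "S / 2 * r\<^sup>2 \<le> Q" and Q2: "Q \<le> 3 / 2 * S * r\<^sup>2" and rS: "r\<^sup>2 \<le> 2 * S"
    unfolding S_def r_def Q_def
    using cubic_monotone_lower[of a b] cubic_monotone_upper[of a b] norm_diff_sq_le[of a b] by auto
  have Q0: "0 \<le> Q" using Q1 S by (smt (verit) divide_nonneg_pos mult_nonneg_nonneg zero_le_power2)
  have right: "?r = g r * Q" by (simp add: force_def r_def Q_def)
  have LS: "0 \<le> 3 / 2 * L * \<rho>0\<^sup>2 * S" using L S by simp
  have "K / 4 * (r\<^sup>2 - \<rho>\<^sup>2) - 3 / 2 * L * \<rho>0\<^sup>2 * S \<le> g r * Q"
  proof -
    consider "\<rho> \<le> r" | "\<rho>0 \<le> r" "r < \<rho>" | "r < \<rho>0" by linarith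
    then show ?thesis
    proof cases
      case 1
      then have "g r * (S / 2 * r\<^sup>2) \<le> g r * Q" using Q1 g_nonneg[of r] \<rho> by (intro mult_left_mono) auto
      moreover have "K * (S / 2) \<le> (g r * r\<^sup>2) * (S / 2)" using g_far[OF 1] S by (intro mult_right_mono) auto
      moreover have "K / 4 * (r\<^sup>2 - \<rho>\<^sup>2) \<le> K / 4 * (2 * S)"
        using rS K_pos by (intro mult_left_mono) (auto intro: order_trans[of _ "r\<^sup>2"])
      ultimately show ?thesis using LS by (simp add: algebra_simps)
    next
      case 2
      then have "r\<^sup>2 \<le> \<rho>\<^sup>2" using r by (intro power_mono) auto
      then have "K / 4 * (r\<^sup>2 - \<rho>\<^sup>2) \<le> 0" using K_pos by (intro mult_nonneg_nonpos) auto
      moreover have "0 \<le> g r * Q" using 2 g_nonneg Q0 by simp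
      ultimately show ?thesis using LS by linarith
    next
      case 3
      then have "r\<^sup>2 \<le> \<rho>\<^sup>2" using r \<rho> by (intro power_mono) auto
      then have "K / 4 * (r\<^sup>2 - \<rho>\<^sup>2) \<le> 0" using K_pos by (intro mult_nonneg_nonpos) auto
      moreover have "- (3 / 2 * L * \<rho>0\<^sup>2 * S) \<le> g r * Q"
      proof (cases "r = 0")
        case True
        then have "Q = 0" unfolding r_def Q_def by simp
        then show ?thesis using LS by simp
      next
        case False
        have "3 / 2 * S * r\<^sup>2 \<le> 3 / 2 * S * \<rho>0\<^sup>2" using 3 r S by (intro mult_left_mono power_mono) auto
        then have "L * Q \<le> L * (3 / 2 * S * \<rho>0\<^sup>2)" using L Q2 by (intro mult_left_mono) auto
        moreover have "- L * Q \<le> g r * Q" using g_ge[of r] r False Q0 by (intro mult_right_mono) auto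
        ultimately show ?thesis by (simp add: algebra_simps)
      qed
      ultimately show ?thesis by linarith
    qed
  qed
  then show ?thesis unfolding right S_def r_def .
qed

text \<open>For \<open>\<bar>b\<bar> \<le> \<bar>a\<bar>\<close> one has \<open>\<bar>a - b\<bar>\<^sup>2 / 2 \<le> (a - b) \<bullet> a\<close>, so attraction towards \<open>b\<close> has an inward
  radial part.  The first term on the left is nonpositive for close pairs, and averages to almost
  \<open>K / 4\<close> because \<open>(a - b) \<bullet> a\<close> averages to \<open>R\<^sup>2\<close> when the centre of mass is \<open>0\<close>.\<close>

lemma extremal_pair:
  fixes a b :: "'a::real_inner"
  assumes a: "norm a = R" and b: "norm b \<le> R" and R: "2 * \<rho> \<le> R"
  shows "K / 4 * ((a - b) \<bullet> a / R\<^sup>2 - \<rho> / R) - 16 * L * \<rho>0 * norm b ^ 4 / R ^ 3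
      \<le> a \<bullet> force (a - b)"
proof -
  define r where "r = norm (a - b)"
  define e where "e = (a - b) \<bullet> a"
  have Rpos: "0 < R" using R \<rho> \<rho>0 by linarith
  have r: "0 \<le> r" by (auto simp: r_def)
  have bR: "(norm b)\<^sup>2 \<le> R\<^sup>2" using b by (intro power_mono) auto
  have "r\<^sup>2 = 2 * e + (norm b)\<^sup>2 - R\<^sup>2"
    unfolding r_def e_def a[symmetric]
    by (simp add: power2_norm_eq_inner inner_simps inner_commute)
  then have re: "r\<^sup>2 \<le> 2 * e" using bR by simp
  have e0: "0 \<le> e" using re by (smt (verit) zero_le_power2)
  have er: "e \<le> r * R" unfolding e_def r_def a[symmetric] by (rule norm_cauchy_schwarz)
  have r2R: "r \<le> 2 * R" unfolding r_def using norm_triangle_ineq4[of a b] a b by simp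
  have right: "a \<bullet> force (a - b) = g r * e"
    by (simp add: force_def r_def e_def inner_commute)
  have B: "0 \<le> 16 * L * \<rho>0 * norm b ^ 4 / R ^ 3" using L \<rho>0 Rpos by simp
  have near: "K / 4 * (e / R\<^sup>2 - \<rho> / R) \<le> 0" if "r \<le> \<rho>"
  proof -
    have "e \<le> \<rho> * R" using er that Rpos by (meson mult_right_mono order_trans less_imp_le)
    then have "e / R\<^sup>2 \<le> \<rho> / R" using Rpos by (simp add: field_simps power2_eq_square)
    then show ?thesis using K_pos by (intro mult_nonneg_nonpos) auto
  qed
  have "K / 4 * (e / R\<^sup>2 - \<rho> / R) - 16 * L * \<rho>0 * norm b ^ 4 / R ^ 3 \<le> g r * e"
  proof -
    consider "\<rho> \<le> r" | "\<rho>0 \<le> r" "r < \<rho>" | "r < \<rho>0" by linarith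
    then show ?thesis
    proof cases
      case 1
      have "g r * (r\<^sup>2 / 2) \<le> g r * e" using re g_nonneg[of r] 1 \<rho> by (intro mult_left_mono) auto
      then have "K / 2 \<le> g r * e" using g_far[OF 1] by simp
      moreover have "e / R\<^sup>2 - \<rho> / R \<le> 2"
      proof -
        have "e \<le> 2 * R * R" using er r2R Rpos by (meson mult_right_mono order_trans less_imp_le)
        then have "e / R\<^sup>2 \<le> 2" using Rpos by (simp add: field_simps power2_eq_square)
        moreover have "0 \<le> \<rho> / R" using Rpos \<rho> \<rho>0 by simp
        ultimately show ?thesis by linarith
      qed
      then have "K / 4 * (e / R\<^sup>2 - \<rho> / R) \<le> K / 4 * 2" using K_pos by (intro mult_left_mono) auto
      ultimately show ?thesis using B by linarith
    next
      case 2
      then have "0 \<le> g r * e" using g_nonneg e0 by simp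
      then show ?thesis using near 2 B by linarith
    next
      case 3
      have "- (16 * L * \<rho>0 * norm b ^ 4 / R ^ 3) \<le> g r * e"
      proof (cases "r = 0")
        case True
        then have "e = 0" unfolding r_def e_def by simp
        then show ?thesis using B by simp
      next
        case False
        \<comment> \<open>The neighbour lies outside the ball of radius \<open>R / 2\<close>, so its fourth moment pays
           for the repulsion.\<close>
        have "R / 2 \<le> norm b" using norm_triangle_ineq2[of a b] a 3 R \<rho> unfolding r_def by linarith
        then have "(R / 2) ^ 4 \<le> norm b ^ 4" using Rpos by (intro power_mono) auto
        then have "R * R ^ 3 \<le> 16 * norm b ^ 4" by (simp add: power_divide eval_nat_numeral)
        then have R1: "R \<le> 16 * norm b ^ 4 / R ^ 3" using Rpos by (simp add: pos_le_divide_eq)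
        have "e \<le> \<rho>0 * R" using er 3 Rpos by (meson mult_right_mono order_trans less_imp_le)
        also have "\<dots> \<le> \<rho>0 * (16 * norm b ^ 4 / R ^ 3)" using R1 \<rho>0 by (intro mult_left_mono) auto
        finally have "L * e \<le> L * (\<rho>0 * (16 * norm b ^ 4 / R ^ 3))" using L by (intro mult_left_mono)
        moreover have "- L * e \<le> g r * e" using g_ge[of r] r False e0 by (intro mult_right_mono) auto
        ultimately show ?thesis by (simp add: algebra_simps)
      qed
      then show ?thesis using near 3 \<rho> by linarith
    qed
  qed
  then show ?thesis unfolding right e_def .
qed

context
  fixes I :: "'i set" and m :: "'i \<Rightarrow> real" and x :: "'i \<Rightarrow> 'a::real_inner"
  assumes m: "\<And>i. i \<in> I \<Longrightarrow> 0 \<le> m i" and m1: "sum m I = 1"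
    and centre: "(\<Sum>i\<in>I. m i *\<^sub>R x i) = 0"
begin

text \<open>The sum on the right is \<open>- F' / 4\<close> for the fourth moment \<open>F\<close>.  Exchanging the two particles of each
  pair turns it into half the sum of the terms of \<open>pair_dissipation\<close>.\<close>

lemma fourth_moment_dissipation:
  "(\<Sum>i\<in>I. m i * (norm (x i))\<^sup>2) - K * \<rho>\<^sup>2 / 8
    \<le> (\<Sum>i\<in>I. m i * ((norm (x i))\<^sup>2 * (x i \<bullet> (\<Sum>j\<in>I. m j *\<^sub>R force (x i - x j)))))"
proof -
  define M where "M = (\<Sum>i\<in>I. m i * (norm (x i))\<^sup>2)"
  define D where "D = (\<Sum>i\<in>I. \<Sum>j\<in>I. m i * m j * ((norm (x i))\<^sup>2 *\<^sub>R x i \<bullet> force (x i - x j)))"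
  have D: "(\<Sum>i\<in>I. m i * ((norm (x i))\<^sup>2 * (x i \<bullet> (\<Sum>j\<in>I. m j *\<^sub>R force (x i - x j))))) = D"
    unfolding D_def by (simp add: inner_sum_right sum_distrib_left mult_ac)
  have "D = (\<Sum>i\<in>I. \<Sum>j\<in>I. m j * m i * ((norm (x j))\<^sup>2 *\<^sub>R x j \<bullet> force (x j - x i)))"
    unfolding D_def by (rule sum.swap)
  also have "\<dots> = (\<Sum>i\<in>I. \<Sum>j\<in>I. m i * m j * - ((norm (x j))\<^sup>2 *\<^sub>R x j \<bullet> force (x i - x j)))"
    by (intro sum.cong refl) (metis force_minus inner_minus_right minus_diff_eq mult.commute)
  finally have "2 * D = (\<Sum>i\<in>I. \<Sum>j\<in>I. m i * m j *
      (force (x i - x j) \<bullet> ((norm (x i))\<^sup>2 *\<^sub>R x i - (norm (x j))\<^sup>2 *\<^sub>R x j)))"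
    unfolding D_def
    by (simp add: inner_diff_right inner_commute right_diff_distrib sum_subtractf sum_negf)
  moreover have "(\<Sum>i\<in>I. \<Sum>j\<in>I. m i * m j *
      (K / 4 * ((norm (x i - x j))\<^sup>2 - \<rho>\<^sup>2) - 3 / 2 * L * \<rho>0\<^sup>2 * ((norm (x i))\<^sup>2 + (norm (x j))\<^sup>2))) \<le> \<dots>"
    by (intro sum_mono mult_left_mono pair_dissipation mult_nonneg_nonneg m)
  moreover have "(\<Sum>i\<in>I. \<Sum>j\<in>I. m i * m j *
      (K / 4 * ((norm (x i - x j))\<^sup>2 - \<rho>\<^sup>2) - 3 / 2 * L * \<rho>0\<^sup>2 * ((norm (x i))\<^sup>2 + (norm (x j))\<^sup>2)))
    = K / 4 * (2 * M - \<rho>\<^sup>2) - 3 / 2 * L * \<rho>0\<^sup>2 * (2 * M)"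
  proof -
    have s1: "(\<Sum>i\<in>I. \<Sum>j\<in>I. m i * m j * (norm (x i))\<^sup>2) = M"
    proof -
      have "(\<Sum>j\<in>I. m i * m j * (norm (x i))\<^sup>2) = m i * (norm (x i))\<^sup>2" for i
        using m1 by (simp add: mult_ac flip: sum_distrib_left sum_distrib_right)
      then show ?thesis by (simp add: M_def)
    qed
    have s2: "(\<Sum>i\<in>I. \<Sum>j\<in>I. m i * m j * (norm (x j))\<^sup>2) = M"
      using s1 by (subst sum.swap) (simp add: mult_ac)
    have s3: "(\<Sum>i\<in>I. \<Sum>j\<in>I. m i * m j * (x i \<bullet> x j)) = 0"
    proof -
      have "(\<Sum>i\<in>I. \<Sum>j\<in>I. m i * m j * (x i \<bullet> x j)) = (\<Sum>i\<in>I. m i *\<^sub>R x i) \<bullet> (\<Sum>j\<in>I. m j *\<^sub>R x j)"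
        by (subst sum.swap) (simp add: inner_sum_left inner_sum_right sum_distrib_left mult_ac)
      then show ?thesis by (simp add: centre)
    qed
    have s4: "(\<Sum>i\<in>I. m i * sum m I) = 1"
      using m1 by simp
    have "m i * m j * (K / 4 * ((norm (x i - x j))\<^sup>2 - \<rho>\<^sup>2) - 3 / 2 * L * \<rho>0\<^sup>2 * ((norm (x i))\<^sup>2 + (norm (x j))\<^sup>2))
      = (K / 4 - 3 / 2 * L * \<rho>0\<^sup>2) * (m i * m j * (norm (x i))\<^sup>2)
      + (K / 4 - 3 / 2 * L * \<rho>0\<^sup>2) * (m i * m j * (norm (x j))\<^sup>2)
      + (- K / 2) * (m i * m j * (x i \<bullet> x j)) + (- K / 4 * \<rho>\<^sup>2) * (m i * m j)" for i j
      by (simp add: power2_norm_eq_inner inner_simps inner_commute) (simp add: field_simps)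
    then show ?thesis
      by (simp only: sum.distrib sum_distrib_left[symmetric] s1 s2 s3 s4) (simp add: algebra_simps)
  qed
  ultimately have "K / 4 * (2 * M - \<rho>\<^sup>2) - 3 / 2 * L * \<rho>0\<^sup>2 * (2 * M) \<le> 2 * D" by linarith
  moreover have "K / 4 * (2 * M - \<rho>\<^sup>2) - 3 / 2 * L * \<rho>0\<^sup>2 * (2 * M) = 2 * M - 2 * (K * \<rho>\<^sup>2 / 8)"
    by (simp add: K field_simps)
  ultimately have "M - K * \<rho>\<^sup>2 / 8 \<le> D" by linarith
  then show ?thesis unfolding D M_def .
qed

lemma extremal_particle_pulled_inward:
  assumes i: "i \<in> I" and xi: "norm (x i) = R" and R: "2 * \<rho> \<le> R"
    and le: "\<And>j. j \<in> I \<Longrightarrow> norm (x j) \<le> R"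
    and F: "(\<Sum>j\<in>I. m j * norm (x j) ^ 4) \<le> C * R\<^sup>2" and C: "32 * L * \<rho>0 * C < R"
  shows "0 < x i \<bullet> (\<Sum>j\<in>I. m j *\<^sub>R force (x i - x j))"
proof -
  have Rpos: "0 < R" using R \<rho> \<rho>0 by linarith
  have e: "(\<Sum>j\<in>I. m j * ((x i - x j) \<bullet> x i)) = R\<^sup>2"
  proof -
    have "(\<Sum>j\<in>I. m j * ((x i - x j) \<bullet> x i)) = (x i \<bullet> x i) * sum m I - (\<Sum>j\<in>I. m j *\<^sub>R x j) \<bullet> x i"
      by (simp add: inner_sum_left inner_diff_left right_diff_distrib sum_subtractf sum_distrib_left sum_distrib_right mult_ac)
    then show ?thesis using m1 centre xi by (simp add: power2_norm_eq_inner[symmetric])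
  qed
  have "K / 4 * (1 - \<rho> / R) - 16 * L * \<rho>0 / R ^ 3 * (\<Sum>j\<in>I. m j * norm (x j) ^ 4)
     = (\<Sum>j\<in>I. m j * (K / 4 * ((x i - x j) \<bullet> x i / R\<^sup>2 - \<rho> / R) - 16 * L * \<rho>0 * norm (x j) ^ 4 / R ^ 3))"
  proof -
    have "m j * (K / 4 * ((x i - x j) \<bullet> x i / R\<^sup>2 - \<rho> / R) - 16 * L * \<rho>0 * norm (x j) ^ 4 / R ^ 3)
      = K / (4 * R\<^sup>2) * (m j * ((x i - x j) \<bullet> x i)) - K / 4 * (\<rho> / R) * m j
        - 16 * L * \<rho>0 / R ^ 3 * (m j * norm (x j) ^ 4)" for j
      by (simp add: right_diff_distrib mult_ac)
    then show ?thesis using Rpos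
      by (simp only: sum_subtractf sum_distrib_left[symmetric] e m1) (simp add: right_diff_distrib)
  qed
  also have "\<dots> \<le> (\<Sum>j\<in>I. m j * (x i \<bullet> force (x i - x j)))"
    using xi R le by (intro sum_mono mult_left_mono extremal_pair m) auto
  also have "\<dots> = x i \<bullet> (\<Sum>j\<in>I. m j *\<^sub>R force (x i - x j))" by (simp add: inner_sum_right)
  finally have low: "K / 4 * (1 - \<rho> / R) - 16 * L * \<rho>0 / R ^ 3 * (\<Sum>j\<in>I. m j * norm (x j) ^ 4)
     \<le> x i \<bullet> (\<Sum>j\<in>I. m j *\<^sub>R force (x i - x j))" .
  have "16 * L * \<rho>0 / R ^ 3 * (\<Sum>j\<in>I. m j * norm (x j) ^ 4) \<le> 16 * L * \<rho>0 / R ^ 3 * (C * R\<^sup>2)"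
    using L \<rho>0 Rpos by (intro mult_left_mono F) auto
  also have "\<dots> = 16 * L * \<rho>0 * C / R" using Rpos by (simp add: field_simps eval_nat_numeral)
  also have "\<dots> < 1 / 2" using C Rpos by (simp add: field_simps)
  finally have "16 * L * \<rho>0 / R ^ 3 * (\<Sum>j\<in>I. m j * norm (x j) ^ 4) < 1 / 2" .
  moreover have "1 * (1 / 2) \<le> K / 4 * (1 - \<rho> / R)"
    using K_pos R Rpos by (intro mult_mono) (auto simp: field_simps)
  ultimately show ?thesis using low by linarith
qed

end

section \<open>Confinement of the particle system\<close>

text \<open>Time enters through two barriers.  The inner one bounds \<open>F\<close> up to time \<open>s\<close> by a multiple of \<open>r\<^sup>2\<close>
  if all particles stay within radius \<open>r\<close> until then; the outer one applies this at the time when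
  the largest \<open>\<bar>x i\<bar>\<^sup>2\<close> first reaches a level \<open>r\<^sup>2\<close>.  The extremal particle is treated regardless of its
  mass, so massless particles are confined too.\<close>

lemma particles_confined:
  fixes x :: "'i \<Rightarrow> real \<Rightarrow> 'a::euclidean_space"
  assumes fin: "finite I" and m: "\<And>i. i \<in> I \<Longrightarrow> 0 \<le> m i" and m1: "sum m I = 1"
    and T: "finite T"
    and cont: "\<And>i. i \<in> I \<Longrightarrow> continuous_on {0..} (x i)"
    and ode: "\<And>i t. i \<in> I \<Longrightarrow> 0 \<le> t \<Longrightarrow> t \<notin> T \<Longrightarrow>
      (x i has_vector_derivative - (\<Sum>j\<in>I. m j *\<^sub>R force (x i t - x j t))) (at t within {0..})"
    and init: "\<And>i. i \<in> I \<Longrightarrow> norm (x i 0) \<le> R0"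
    and centre0: "(\<Sum>i\<in>I. m i *\<^sub>R x i 0) = 0"
    and R: "R0 \<le> R" "2 * \<rho> \<le> R" "R0 ^ 4 + 1 \<le> R\<^sup>2" "32 * L * \<rho>0 * (K * \<rho>\<^sup>2 / 8 + 1) < R"
    and i: "i \<in> I" and t: "0 \<le> t"
  shows "norm (x i t) < R + 1"
proof -
  define v where "v i t = - (\<Sum>j\<in>I. m j *\<^sub>R force (x i t - x j t))" for i t
  note ode = ode[folded v_def]
  have Rpos: "0 < R" using R \<rho> \<rho>0 by linarith
  have centre: "(\<Sum>i\<in>I. m i *\<^sub>R x i t) = 0" if "0 \<le> t" for t
  proof -
    have "(\<Sum>i\<in>I. m i *\<^sub>R v i t) = 0" for t
    proof -
      have v: "(\<Sum>i\<in>I. m i *\<^sub>R v i t) = - (\<Sum>i\<in>I. \<Sum>j\<in>I. (m i * m j) *\<^sub>R force (x i t - x j t))" (is "_ = - ?S")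
        by (simp add: v_def scaleR_sum_right sum_negf)
      \<comment> \<open>Action equals reaction: the total force \<open>?S\<close> equals its own negative.\<close>
      have swap: "(m j * m i) *\<^sub>R force (x j t - x i t) = - ((m i * m j) *\<^sub>R force (x i t - x j t))"
        for i j
        using force_minus[of "x i t - x j t"] by (simp add: mult.commute)
      have "?S = (\<Sum>i\<in>I. \<Sum>j\<in>I. (m j * m i) *\<^sub>R force (x j t - x i t))" by (rule sum.swap)
      also have "\<dots> = - ?S" unfolding sum_negf[symmetric] by (intro sum.cong refl swap)
      finally have "?S + ?S = 0" by (rule add_eq_0_iff[THEN iffD2])
      then have "?S = 0" by (simp flip: scaleR_2)
      then show ?thesis using v by simp
    qed
    then have "((\<lambda>t. \<Sum>i\<in>I. m i *\<^sub>R x i t) has_vector_derivative 0) (at u within {0..t})"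
      if "u \<in> {0..t} - T" for u
    proof -
      have "((\<lambda>t. \<Sum>i\<in>I. m i *\<^sub>R x i t) has_vector_derivative (\<Sum>i\<in>I. m i *\<^sub>R v i u)) (at u within {0..})"
        using that ode
        by (intro has_vector_derivative_sum
            bounded_linear.has_vector_derivative[OF bounded_linear_scaleR_right]) auto
      then show ?thesis
        using \<open>\<And>t. (\<Sum>i\<in>I. m i *\<^sub>R v i t) = 0\<close>
        by (auto intro: has_vector_derivative_within_subset)
    qed
    then have deriv0: "((\<lambda>t. \<Sum>i\<in>I. m i *\<^sub>R x i t) has_derivative (\<lambda>h. 0)) (at u within {0..t})"
      if "u \<in> {0..t} - T" for u
      using that unfolding has_vector_derivative_def by simp
    have "continuous_on {0..t} (\<lambda>t. \<Sum>i\<in>I. m i *\<^sub>R x i t)"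
      by (intro continuous_on_sum continuous_on_scaleR continuous_on_const
          continuous_on_subset[OF cont]) auto
    from has_derivative_zero_unique_strong_interval[OF T this centre0 deriv0, of t]
    show ?thesis using that by simp
  qed
  define F where "F t = (\<Sum>i\<in>I. m i * norm (x i t) ^ 4)" for t
  have F_deriv: "\<exists>D \<le> 4 * (K * \<rho>\<^sup>2 / 8 - (\<Sum>i\<in>I. m i * (norm (x i t))\<^sup>2)).
      (F has_real_derivative D) (at t within {0..})" if t: "0 \<le> t" "t \<notin> T" for t
  proof -
    have "((\<lambda>t. \<Sum>i\<in>I. m i * (x i t \<bullet> x i t)\<^sup>2) has_real_derivative
        (\<Sum>i\<in>I. m i * (4 * ((norm (x i t))\<^sup>2 * (x i t \<bullet> v i t))))) (at t within {0..})"
    proof (intro DERIV_sum DERIV_cmult)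
      fix i assume "i \<in> I"
      have "((\<lambda>t. x i t \<bullet> x i t) has_real_derivative (x i t \<bullet> v i t + v i t \<bullet> x i t)) (at t within {0..})"
        using bounded_bilinear.has_vector_derivative[OF bounded_bilinear_inner
            ode[OF \<open>i \<in> I\<close> t] ode[OF \<open>i \<in> I\<close> t]]
        by (simp add: has_real_derivative_iff_has_vector_derivative)
      then show "((\<lambda>t. (x i t \<bullet> x i t)\<^sup>2) has_real_derivative 4 * ((norm (x i t))\<^sup>2 * (x i t \<bullet> v i t)))
          (at t within {0..})"
        by (auto intro!: derivative_eq_intros simp: power2_norm_eq_inner inner_commute)
    qed
    moreover have "F = (\<lambda>t. \<Sum>i\<in>I. m i * (x i t \<bullet> x i t)\<^sup>2)"
      unfolding F_def by (simp add: fun_eq_iff flip: power2_norm_eq_inner)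
    moreover have "(\<Sum>i\<in>I. m i * (4 * ((norm (x i t))\<^sup>2 * (x i t \<bullet> v i t)))) =
       - 4 * (\<Sum>i\<in>I. m i * ((norm (x i t))\<^sup>2 * (x i t \<bullet> (\<Sum>j\<in>I. m j *\<^sub>R force (x i t - x j t)))))"
      by (simp add: v_def sum_distrib_left sum_negf mult_ac)
    ultimately have "(F has_real_derivative - 4 * (\<Sum>i\<in>I. m i * ((norm (x i t))\<^sup>2 *
        (x i t \<bullet> (\<Sum>j\<in>I. m j *\<^sub>R force (x i t - x j t)))))) (at t within {0..})" by simp
    moreover have "- 4 * (\<Sum>i\<in>I. m i * ((norm (x i t))\<^sup>2 *
        (x i t \<bullet> (\<Sum>j\<in>I. m j *\<^sub>R force (x i t - x j t)))))
      \<le> 4 * (K * \<rho>\<^sup>2 / 8 - (\<Sum>i\<in>I. m i * (norm (x i t))\<^sup>2))"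
    proof -
      have "(\<Sum>i\<in>I. m i * (norm (x i t))\<^sup>2) - K * \<rho>\<^sup>2 / 8
        \<le> (\<Sum>i\<in>I. m i * ((norm (x i t))\<^sup>2 * (x i t \<bullet> (\<Sum>j\<in>I. m j *\<^sub>R force (x i t - x j t)))))"
        by (rule fourth_moment_dissipation) (use m m1 centre[OF t(1)] in auto)
      then show ?thesis by argo
    qed
    ultimately show ?thesis by blast
  qed
  have F_bound: "F s \<le> (K * \<rho>\<^sup>2 / 8 + 1) * r\<^sup>2"
    if s: "0 \<le> s" and r: "R \<le> r" and le: "\<And>j u. j \<in> I \<Longrightarrow> 0 \<le> u \<Longrightarrow> u \<le> s \<Longrightarrow> norm (x j u) \<le> r" for s r
  proof -
    have rpos: "0 < r" using Rpos r by simp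
    define a where "a = K * \<rho>\<^sup>2 / 8 * r\<^sup>2 + R0 ^ 4"
    have "F 0 \<le> (\<Sum>i\<in>I. m i * R0 ^ 4)"
      unfolding F_def by (intro sum_mono mult_left_mono power_mono m init) auto
    also have "\<dots> = R0 ^ 4" using m1 by (simp flip: sum_distrib_right)
    finally have F0: "F 0 \<le> a" unfolding a_def using K_pos by (simp add: add_increasing)
    have "F s < a + 1"
    proof (rule barrier_off_finite_set[of "{()}" T a "a + 1" s "\<lambda>_. F" "()" s])
      show "continuous_on {0..s} F"
        unfolding F_def by (intro continuous_intros continuous_on_subset[OF cont]) auto
      fix y u assume y: "a < y" and u: "0 < u" "u \<le> s" "u \<notin> T" "F u = y"
      have "F u \<le> (\<Sum>i\<in>I. m i * ((norm (x i u))\<^sup>2 * r\<^sup>2))"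
        unfolding F_def
      proof (intro sum_mono mult_left_mono m)
        fix j assume "j \<in> I"
        then have "(norm (x j u))\<^sup>2 \<le> r\<^sup>2" using le[of j u] u by (intro power_mono) auto
        then have "(norm (x j u))\<^sup>2 * (norm (x j u))\<^sup>2 \<le> (norm (x j u))\<^sup>2 * r\<^sup>2" by (intro mult_left_mono) auto
        then show "norm (x j u) ^ 4 \<le> (norm (x j u))\<^sup>2 * r\<^sup>2" by (simp add: eval_nat_numeral)
      qed
      then have "y \<le> (\<Sum>i\<in>I. m i * (norm (x i u))\<^sup>2) * r\<^sup>2"
        using u by (simp add: sum_distrib_right mult.assoc)
      moreover have "K * \<rho>\<^sup>2 / 8 * r\<^sup>2 < y" using y zero_le_even_power[of 4 R0, OF even_numeral] unfolding a_def by linarith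
      ultimately have "K * \<rho>\<^sup>2 / 8 * r\<^sup>2 < (\<Sum>i\<in>I. m i * (norm (x i u))\<^sup>2) * r\<^sup>2" by linarith
      then have "K * \<rho>\<^sup>2 / 8 < (\<Sum>i\<in>I. m i * (norm (x i u))\<^sup>2)" using rpos by simp
      then show "\<exists>D<0. (F has_real_derivative D) (at u within {0..})"
        using F_deriv[of u] u by force
    qed (use T s F0 in auto)
    moreover have "R0 ^ 4 + 1 \<le> r\<^sup>2" using R(3) power_mono[OF r, of 2] Rpos by simp
    ultimately show ?thesis unfolding a_def by (simp add: algebra_simps)
  qed
  have "(norm (x i t))\<^sup>2 < (R + 1)\<^sup>2"
  proof (rule barrier_off_finite_set[of I T "R\<^sup>2" "(R + 1)\<^sup>2" t "\<lambda>i t. (norm (x i t))\<^sup>2" i t])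
    show "R\<^sup>2 < (R + 1)\<^sup>2" using Rpos by (intro power_strict_mono) auto
    show "continuous_on {0..t} (\<lambda>t. (norm (x i t))\<^sup>2)" if "i \<in> I" for i
      by (intro continuous_intros continuous_on_subset[OF cont[OF that]]) auto
    show "(norm (x i 0))\<^sup>2 \<le> R\<^sup>2" if "i \<in> I" for i
      using init[OF that] R by (intro power_mono) auto
    fix k y s assume k: "k \<in> I" and y: "R\<^sup>2 < y" and s: "0 < s" "s \<notin> T" "(norm (x k s))\<^sup>2 = y"
      and le: "\<And>j u. j \<in> I \<Longrightarrow> 0 \<le> u \<Longrightarrow> u \<le> s \<Longrightarrow> (norm (x j u))\<^sup>2 \<le> y"
    define r where "r = norm (x k s)"
    have r: "R \<le> r" using y s(3) Rpos unfolding r_def by (metis less_eq_real_def norm_ge_zero power_less_imp_less_base)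
    have le': "norm (x j u) \<le> r" if "j \<in> I" "0 \<le> u" "u \<le> s" for j u
      using le[OF that] s(3) unfolding r_def by (metis norm_ge_zero power2_le_imp_le)
    have "0 < x k s \<bullet> (\<Sum>j\<in>I. m j *\<^sub>R force (x k s - x j s))"
    proof (rule extremal_particle_pulled_inward[where x = "\<lambda>j. x j s" and R = r])
      show "(\<Sum>j\<in>I. m j * norm (x j s) ^ 4) \<le> (K * \<rho>\<^sup>2 / 8 + 1) * r\<^sup>2"
        using F_bound[OF _ r le'] s unfolding F_def by auto
      show "norm (x j s) \<le> r" if "j \<in> I" for j using le'[OF that] s by simp
      show "norm (x k s) = r" "2 * \<rho> \<le> r" "32 * L * \<rho>0 * (K * \<rho>\<^sup>2 / 8 + 1) < r"
        using R r by (auto simp: r_def)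
    qed (use m m1 k s centre in auto)
    moreover have "((\<lambda>t. x k t \<bullet> x k t) has_real_derivative (x k s \<bullet> v k s + v k s \<bullet> x k s)) (at s within {0..})"
      using bounded_bilinear.has_vector_derivative[OF bounded_bilinear_inner ode ode, of k s k] k s
      by (simp add: has_real_derivative_iff_has_vector_derivative)
    ultimately show "\<exists>D<0. ((\<lambda>t. (norm (x k t))\<^sup>2) has_real_derivative D) (at s within {0..})"
      by (intro exI[of _ "x k s \<bullet> v k s + v k s \<bullet> x k s"])
         (simp add: power2_norm_eq_inner v_def inner_commute)
  qed (use fin T i t in auto)
  then show ?thesis using Rpos by (simp add: power_less_imp_less_base)
qed

end

theorem mainTheorem1:
  fixes W :: "real ^ 'N \<Rightarrow> real"
  assumes "NL0 W" and "NL1 W" and "NL2 W" and "NL_RAD W" and "NL_CONF W"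
  shows "\<forall>R0>0. \<exists>R>0. \<forall>n\<ge>1. \<forall>(m :: nat \<Rightarrow> real) (x :: nat \<Rightarrow> real \<Rightarrow> real ^ 'N).
           (\<forall>i\<in>{1..n}. m i \<ge> 0) \<longrightarrow>
           (\<Sum>i\<in>{1..n}. m i) = 1 \<longrightarrow>
           (\<forall>i\<in>{1..n}. x i 0 \<in> ball 0 R0) \<longrightarrow>
           (\<Sum>i\<in>{1..n}. m i *\<^sub>R x i 0) = 0 \<longrightarrow>
           particle_solution W n m x \<longrightarrow>
           (\<forall>t\<ge>0. \<forall>i\<in>{1..n}. x i t \<in> ball 0 R)"
proof (intro allI impI)
  fix R0 :: real assume R0: "0 < R0"
  obtain w where w: "radial_profile W w" and lim: "filterlim (\<lambda>r. deriv w r * r) at_top at_top"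
    using \<open>NL_CONF W\<close> unfolding NL_CONF_def by auto
  obtain l where l: "convex_on UNIV (\<lambda>z. W z - l / 2 * (norm z)\<^sup>2)"
    using \<open>NL1 W\<close> unfolding NL1_def by auto
  define g where "g r = deriv w r / r" for r
  define L where "L = \<bar>l\<bar>"
  have far: "\<exists>\<rho>\<ge>c. \<forall>r\<ge>\<rho>. k \<le> g r * r\<^sup>2" if "0 < c" for c k
  proof -
    obtain b where b: "\<And>r. b \<le> r \<Longrightarrow> k \<le> deriv w r * r"
      using lim unfolding filterlim_at_top eventually_at_top_linorder by meson
    have "k \<le> g r * r\<^sup>2" if "max b c \<le> r" for r
      using b[of r] that \<open>0 < c\<close> by (simp add: g_def power2_eq_square)
    then show ?thesis by (intro exI[of _ "max b c"]) auto
  qed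
  obtain \<rho>0 where \<rho>0: "1 \<le> \<rho>0" and nonneg: "\<And>r. \<rho>0 \<le> r \<Longrightarrow> 0 \<le> g r * r\<^sup>2"
    using far[of 1 0] by auto
  define K where "K = 6 * L * \<rho>0\<^sup>2 + 4"
  obtain \<rho> where \<rho>: "\<rho>0 \<le> \<rho>" and K: "\<And>r. \<rho> \<le> r \<Longrightarrow> K \<le> g r * r\<^sup>2"
    using far[of \<rho>0 K] \<rho>0 by auto
  interpret confining_force g L \<rho>0 \<rho> K
  proof
    show "- L \<le> g r" if "0 < r" for r
    proof -
      have "l \<le> g r"
        using radial_profile_deriv_ge[OF \<open>NL0 W\<close> w that l] that by (simp add: g_def pos_le_divide_eq)
      then show ?thesis unfolding L_def by linarith
    qed
    show "0 \<le> g r" if "\<rho>0 \<le> r" for r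
      using nonneg[OF that] that \<rho>0 by (auto simp: zero_le_mult_iff)
  qed (use \<rho>0 \<rho> K in \<open>auto simp: L_def K_def\<close>)
  \<comment> \<open>The summand \<open>R0 ^ 4 + 1\<close> makes room below \<open>R\<^sup>2\<close> for the initial fourth moment; \<open>C\<close> is the
     radius beyond which the repulsion near an extremal particle is too weak.\<close>
  define C where "C = 32 * L * \<rho>0 * (K * \<rho>\<^sup>2 / 8 + 1)"
  define R where "R = R0 + 2 * \<rho> + R0 ^ 4 + 1 + C + 1"
  have C0: "0 \<le> C" unfolding C_def using L \<rho>0 K_pos by (intro mult_nonneg_nonneg add_nonneg_nonneg) auto
  have Rp: "R0 \<le> R" "2 * \<rho> \<le> R" "R0 ^ 4 + 1 \<le> R" "C < R" "1 \<le> R"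
    using C0 R0 \<rho> \<rho>0 zero_le_power[of R0 4] unfolding R_def by linarith+
  have Rsq: "R0 ^ 4 + 1 \<le> R\<^sup>2" using Rp self_le_power[of R 2] by simp
  show "\<exists>R>0. \<forall>n\<ge>1. \<forall>(m :: nat \<Rightarrow> real) (x :: nat \<Rightarrow> real \<Rightarrow> real ^ 'N).
           (\<forall>i\<in>{1..n}. m i \<ge> 0) \<longrightarrow>
           (\<Sum>i\<in>{1..n}. m i) = 1 \<longrightarrow>
           (\<forall>i\<in>{1..n}. x i 0 \<in> ball 0 R0) \<longrightarrow>
           (\<Sum>i\<in>{1..n}. m i *\<^sub>R x i 0) = 0 \<longrightarrow>
           particle_solution W n m x \<longrightarrow>
           (\<forall>t\<ge>0. \<forall>i\<in>{1..n}. x i t \<in> ball 0 R)"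
  proof (intro exI[of _ "R + 1"] conjI allI impI ballI)
    show "0 < R + 1" using Rp by simp
    fix n :: nat and m :: "nat \<Rightarrow> real" and x :: "nat \<Rightarrow> real \<Rightarrow> real ^ 'N" and t :: real and i :: nat
    assume m: "\<forall>i\<in>{1..n}. m i \<ge> 0" and m1: "(\<Sum>i\<in>{1..n}. m i) = 1"
      and init: "\<forall>i\<in>{1..n}. x i 0 \<in> ball 0 R0" and centre: "(\<Sum>i\<in>{1..n}. m i *\<^sub>R x i 0) = 0"
      and sol: "particle_solution W n m x" and t: "0 \<le> t" and i: "i \<in> {1..n}"
    obtain T where T: "finite T" and sol': "\<forall>i\<in>{1..n}. \<exists>v. continuous_on ({0..} - T) v \<and>
           (\<forall>t\<in>{0..} - T. (x i has_vector_derivative v t) (at t within {0..}) \<and>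
              v t = - (\<Sum>j\<in>interacting n x i t. m j *\<^sub>R grad W (x i t - x j t)))"
      using sol unfolding particle_solution_def by blast
    have ode: "(x i has_vector_derivative - (\<Sum>j\<in>interacting n x i t. m j *\<^sub>R grad W (x i t - x j t)))
        (at t within {0..})" 
      if i: "i \<in> {1..n}" and t: "0 \<le> t" "t \<notin> T" for i t
    proof -
      obtain v where "\<forall>t\<in>{0..} - T. (x i has_vector_derivative v t) (at t within {0..}) \<and>
              v t = - (\<Sum>j\<in>interacting n x i t. m j *\<^sub>R grad W (x i t - x j t))"
        using bspec[OF sol' i] by blast
      from bspec[OF this, of t] t
      have v: "(x i has_vector_derivative v t) (at t within {0..}) \<and>
          v t = - (\<Sum>j\<in>interacting n x i t. m j *\<^sub>R grad W (x i t - x j t))" by blast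
      show ?thesis using conjunct1[OF v] unfolding conjunct2[OF v] .
    qed
    have force: "(\<Sum>j\<in>interacting n x i t. m j *\<^sub>R grad W (x i t - x j t))
        = (\<Sum>j\<in>{1..n}. m j *\<^sub>R force (x i t - x j t))" for i t
    proof (rule sum.mono_neutral_cong_left)
      show "\<forall>j\<in>{1..n} - interacting n x i t. m j *\<^sub>R force (x i t - x j t) = 0"
        by (auto simp: interacting_def force_0)
      show "m j *\<^sub>R grad W (x i t - x j t) = m j *\<^sub>R force (x i t - x j t)" if "j \<in> interacting n x i t" for j
        using that grad_radial[OF \<open>NL0 W\<close> w, of "x i t - x j t"]
        by (auto simp: interacting_def force_def g_def)
    qed (auto simp: interacting_def)
    have "norm (x i t) < R + 1"
    proof (rule particles_confined[of "{1..n}" m T x R0 R i t])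
      show "continuous_on {0..} (x j)" if "j \<in> {1..n}" for j
        using sol that unfolding particle_solution_def by auto
      show "(x j has_vector_derivative - (\<Sum>k\<in>{1..n}. m k *\<^sub>R force (x j s - x k s))) (at s within {0..})"
        if "j \<in> {1..n}" "0 \<le> s" "s \<notin> T" for j s
        using ode[OF that] unfolding force .
      show "norm (x j 0) \<le> R0" if "j \<in> {1..n}" for j
        using bspec[OF init that] by simp
      show "32 * L * \<rho>0 * (K * \<rho>\<^sup>2 / 8 + 1) < R"
        using Rp(4) unfolding C_def .
      show "0 \<le> m j" if "j \<in> {1..n}" for j
        using bspec[OF m that] .
    qed (fact finite_atLeastAtMost m1 T centre Rp Rsq i t)+
    then show "x i t \<in> ball 0 (R + 1)" by simp
  qed
qed

end
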